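(* Every graph that is not vertex-transitive has either an anchor or a connective anchor.
   Context: All graphs are finite and simple; subgraphs are vertex-induced. An anchor of $G$ is a proper nonempty induced subgraph $H$ that occurs exactly once in $G$: no vertex set $W\neq V(H)$ satisfies $G[W]\cong H$. For an induced subgraph $H$ of $G$, the shadow graph $\underline{G}_{/H}$ consists of the background graph $H$ together with one vertex $\underline{s_v}$ for each $v\in V(G)\setminus V(H)$, carrying the subset $N(v)\cap V(H)$ of $V(H)$, where $\underline{s_v},\underline{s_w}$ are adjacent if and only if $v,w$ are adjacent in $G$. Two such shadow graphs $\underline{G}_{/H_1}$ and $\underline{G}_{/H_2}$ are isomorphic if there are a graph isomorphism $f:H_1\to H_2$ and an adjacency- and non-adjacency-preserving bijection between their vertices that sends each vertex with subset $S$ to a vertex with subset $f(S)$. A connective anchor of $G$ is a proper nonempty induced subgraph $H$ that is not necessarily unique but is distinguished by its connection to $G\setminus V(H)$: for every $W\neq V(H)$ with $G[W]\cong H$, the shadow graphs $\underline{G}_{/H}$ and $\underline{G}_{/G[W]}$ are not isomorphic. *)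

theory Defs
  imports "Graph_Theory.Graph_Theory"
begin

text \<open>
  A finite simple graph is a \<^locale>\<open>graph\<close>: a finite, loop-free, symmetric digraph without
  parallel arcs, so that every undirected edge is a pair of opposite arcs and
  \<open>u \<rightarrow>\<^bsub>G\<^esub> v\<close> is adjacency.
\<close>

definition isomorphisms_between ::
    "('a, 'b) pre_digraph \<Rightarrow> ('c, 'd) pre_digraph \<Rightarrow> ('a, 'b, 'c, 'd) digraph_isomorphism set" where
  "isomorphisms_between G H = {f. pre_digraph.digraph_isomorphism G f \<and> H = app_iso f G}"

lemma digraph_iso_iff_isomorphisms_between:
  "digraph_iso G H \<longleftrightarrow> isomorphisms_between G H \<noteq> {}"
  by (auto simp: digraph_iso_def isomorphisms_between_def)

text \<open>The graph without vertices counts as vertex-transitive.\<close>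

definition vertex_transitive :: "('a, 'b) pre_digraph \<Rightarrow> bool" where
  "vertex_transitive G \<longleftrightarrow>
     (\<forall>u\<in>verts G. \<forall>v\<in>verts G. \<exists>f\<in>isomorphisms_between G G. iso_verts f u = v)"

definition neighbourhood :: "('a, 'b) pre_digraph \<Rightarrow> 'a \<Rightarrow> 'a set" where
  "neighbourhood G v = {u \<in> verts G. v \<rightarrow>\<^bsub>G\<^esub> u}"

definition anchor :: "('a, 'b) pre_digraph \<Rightarrow> ('a, 'b) pre_digraph \<Rightarrow> bool" where
  "anchor G H \<longleftrightarrow>
     induced_subgraph H G \<and> verts H \<noteq> {} \<and> verts H \<noteq> verts G \<and>
     (\<forall>W\<subseteq>verts G. W \<noteq> verts H \<longrightarrow> \<not> digraph_iso (G \<restriction> W) H)"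

text \<open>
  The shadow vertices form a graph of their own, and \<open>trace\<close> gives the subset of the
  background vertices carried by each of them. The shadow vertex of \<open>v\<close> is represented by
  \<open>v\<close> itself.
\<close>

record ('a, 'b, 'c, 'd) shadow_graph =
  background :: "('a, 'b) pre_digraph"
  shadows :: "('c, 'd) pre_digraph"
  trace :: "'c \<Rightarrow> 'a set"

definition shadow ::
    "('a, 'b) pre_digraph \<Rightarrow> ('a, 'b) pre_digraph \<Rightarrow> ('a, 'b, 'a, 'b) shadow_graph" where
  "shadow G H =
     \<lparr> background = H,
       shadows = G \<restriction> (verts G - verts H),
       trace = (\<lambda>v. neighbourhood G v \<inter> verts H) \<rparr>"

definition shadow_iso ::
    "('a, 'b, 'c, 'd) shadow_graph \<Rightarrow> ('e, 'f, 'g, 'h) shadow_graph \<Rightarrow> bool" where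
  "shadow_iso S T \<longleftrightarrow>
     (\<exists>f\<in>isomorphisms_between (background S) (background T).
      \<exists>g\<in>isomorphisms_between (shadows S) (shadows T).
        \<forall>s\<in>verts (shadows S). trace T (iso_verts g s) = iso_verts f ` trace S s)"

definition connective_anchor :: "('a, 'b) pre_digraph \<Rightarrow> ('a, 'b) pre_digraph \<Rightarrow> bool" where
  "connective_anchor G H \<longleftrightarrow>
     induced_subgraph H G \<and> verts H \<noteq> {} \<and> verts H \<noteq> verts G \<and>
     (\<forall>W\<subseteq>verts G. W \<noteq> verts H \<longrightarrow> digraph_iso (G \<restriction> W) H \<longrightarrow>
        \<not> shadow_iso (shadow G H) (shadow G (G \<restriction> W)))"

end

theory Submission
  imports Defs
begin

text \<open>
  An isomorphism of shadow graphs \<open>shadow G H\<close> and \<open>shadow G (G \<restriction> W)\<close> consists of a map on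
  the vertices of \<open>H\<close> and a map on the remaining vertices. Glued together they form an
  automorphism of \<open>G\<close>: adjacency within \<open>H\<close> and outside \<open>H\<close> is preserved by the two pieces, and
  adjacency across is what the traces record (\<open>shadow_iso_glue\<close>). This automorphism carries
  \<open>verts H\<close> onto \<open>W\<close>. Hence an induced subgraph whose vertex set is mapped into itself by every
  automorphism is a connective anchor, as soon as it is proper and nonempty
  (\<open>connective_anchor_if_invariant\<close>). If \<open>G\<close> is not vertex-transitive, some vertex \<open>u\<close> is
  mapped by no automorphism to some vertex \<open>v\<close>. The orbit of \<open>u\<close> under the automorphism group is
  then such a vertex set: it contains \<open>u\<close>, misses \<open>v\<close>, and is closed under automorphisms because
  these compose.
\<close>

lemma isomorphisms_between_bij_betw:
  assumes "f \<in> isomorphisms_between G H"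
  shows "bij_betw (iso_verts f) (verts G) (verts H)"
  using assms
  by (auto simp: isomorphisms_between_def bij_betw_def
      dest: pre_digraph.digraph_isomorphism_inj_on_verts)

lemma isomorphisms_between_dominates_iff:
  assumes f: "f \<in> isomorphisms_between G H" and uv: "u \<in> verts G" "v \<in> verts G"
  shows "iso_verts f u \<rightarrow>\<^bsub>H\<^esub> iso_verts f v \<longleftrightarrow> u \<rightarrow>\<^bsub>G\<^esub> v"
proof -
  have iso: "pre_digraph.digraph_isomorphism G f" and H: "H = app_iso f G"
    using f by (auto simp: isomorphisms_between_def)
  interpret wf_digraph G
    using iso by (simp add: pre_digraph.digraph_isomorphism_def)
  have "arcs_ends H = (\<lambda>(u, v). (iso_verts f u, iso_verts f v)) ` arcs_ends G"
    unfolding H by (rule arcs_ends_app_iso_eq[OF iso])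
  moreover have "a = u \<and> b = v"
    if "a \<rightarrow>\<^bsub>G\<^esub> b" "iso_verts f u = iso_verts f a" "iso_verts f v = iso_verts f b" for a b
    using that uv adj_in_verts[OF that(1)] pre_digraph.iso_verts_eq_iff[OF iso] by metis
  ultimately show ?thesis
    by (auto intro: rev_image_eqI)
qed

text \<open>
  Without parallel arcs an isomorphism is determined by its vertex map: the arc map has to send
  each arc to the only arc between the images of its ends.
\<close>

lemma isomorphisms_betweenI:
  assumes G: "nomulti_digraph G" and H: "nomulti_digraph H"
    and bij: "bij_betw \<phi> (verts G) (verts H)"
    and adj: "\<And>u v. u \<in> verts G \<Longrightarrow> v \<in> verts G \<Longrightarrow> \<phi> u \<rightarrow>\<^bsub>H\<^esub> \<phi> v \<longleftrightarrow> u \<rightarrow>\<^bsub>G\<^esub> v"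
  obtains f where "f \<in> isomorphisms_between G H" "iso_verts f = \<phi>"
proof -
  interpret G: nomulti_digraph G by (rule G)
  interpret H: nomulti_digraph H by (rule H)
  define \<alpha> where
    "\<alpha> a = inv_into (arcs H) (arc_to_ends H) (\<phi> (tail G a), \<phi> (head G a))" for a
  have \<alpha>: "\<alpha> a \<in> arcs H" "tail H (\<alpha> a) = \<phi> (tail G a)" "head H (\<alpha> a) = \<phi> (head G a)"
    if "a \<in> arcs G" for a
  proof -
    have "tail G a \<rightarrow>\<^bsub>G\<^esub> head G a"
      using that by (auto simp: arcs_ends_conv)
    then have *: "(\<phi> (tail G a), \<phi> (head G a)) \<in> arc_to_ends H ` arcs H"
      using that adj by (simp add: arcs_ends_def)
    show "\<alpha> a \<in> arcs H"
      unfolding \<alpha>_def using * by (rule inv_into_into)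
    have "arc_to_ends H (\<alpha> a) = (\<phi> (tail G a), \<phi> (head G a))"
      unfolding \<alpha>_def using * by (rule f_inv_into_f)
    then show "tail H (\<alpha> a) = \<phi> (tail G a)" "head H (\<alpha> a) = \<phi> (head G a)"
      by (simp_all add: arc_to_ends_def)
  qed
  have inj: "inj_on \<phi> (verts G)" and surj: "\<phi> ` verts G = verts H"
    using bij by (auto simp: bij_betw_def)
  have "inj_on \<alpha> (arcs G)"
  proof (rule inj_onI)
    fix a b assume ab: "a \<in> arcs G" "b \<in> arcs G" "\<alpha> a = \<alpha> b"
    then have "\<phi> (tail G a) = \<phi> (tail G b)" "\<phi> (head G a) = \<phi> (head G b)"
      using \<alpha>[of a] \<alpha>[of b] by simp_all
    then have "tail G a = tail G b" "head G a = head G b"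
      using inj ab by (auto dest: inj_onD)
    then show "a = b"
      using ab by (intro G.no_multi_arcs) (simp_all add: arc_to_ends_def)
  qed
  moreover have "arcs H \<subseteq> \<alpha> ` arcs G"
  proof
    fix b assume b: "b \<in> arcs H"
    then have "tail H b \<in> \<phi> ` verts G" "head H b \<in> \<phi> ` verts G"
      using surj by auto
    then obtain u v where uv: "u \<in> verts G" "v \<in> verts G" "tail H b = \<phi> u" "head H b = \<phi> v"
      by blast
    have "\<phi> u \<rightarrow>\<^bsub>H\<^esub> \<phi> v"
      using b uv(3,4) by (auto simp: arcs_ends_conv intro: rev_image_eqI)
    then have "u \<rightarrow>\<^bsub>G\<^esub> v"
      using adj uv by simp
    then obtain a where a: "a \<in> arcs G" "tail G a = u" "head G a = v"
      by auto
    then have "\<alpha> a = b"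
      using \<alpha>[of a] b uv by (intro H.no_multi_arcs) (simp_all add: arc_to_ends_def)
    then show "b \<in> \<alpha> ` arcs G"
      using a by blast
  qed
  ultimately have "\<lparr>iso_verts = \<phi>, iso_arcs = \<alpha>, iso_head = head H, iso_tail = tail H\<rparr>
      \<in> isomorphisms_between G H"
    using \<alpha> inj surj G.wf_digraph
    by (auto simp: isomorphisms_between_def pre_digraph.digraph_isomorphism_def
        intro!: pre_digraph.equality)
  then show thesis
    by (rule that) simp
qed

lemma automorphism_id:
  assumes "nomulti_digraph G"
  obtains f where "f \<in> isomorphisms_between G G" "iso_verts f = id"
  by (rule isomorphisms_betweenI[OF assms assms, of id]) auto

lemma automorphism_comp:
  assumes G: "nomulti_digraph G"
    and f: "f \<in> isomorphisms_between G G" and g: "g \<in> isomorphisms_between G G"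
  obtains h where "h \<in> isomorphisms_between G G" "iso_verts h = iso_verts g \<circ> iso_verts f"
proof (rule isomorphisms_betweenI[OF G G, of "iso_verts g \<circ> iso_verts f"])
  show "bij_betw (iso_verts g \<circ> iso_verts f) (verts G) (verts G)"
    by (rule bij_betw_trans[OF isomorphisms_between_bij_betw[OF f] isomorphisms_between_bij_betw[OF g]])
next
  fix u v assume "u \<in> verts G" "v \<in> verts G"
  moreover from this have "iso_verts f u \<in> verts G" "iso_verts f v \<in> verts G"
    using isomorphisms_between_bij_betw[OF f] by (auto dest: bij_betwE)
  ultimately show "(iso_verts g \<circ> iso_verts f) u \<rightarrow>\<^bsub>G\<^esub> (iso_verts g \<circ> iso_verts f) v \<longleftrightarrow> u \<rightarrow>\<^bsub>G\<^esub> v"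
    using f g by (simp add: isomorphisms_between_dominates_iff)
qed (rule that)

lemma induce_subgraph_dominates_iff:
  "u \<rightarrow>\<^bsub>G \<restriction> W\<^esub> v \<longleftrightarrow> u \<in> W \<and> v \<in> W \<and> u \<rightarrow>\<^bsub>G\<^esub> v"
  by (auto simp: arcs_ends_conv image_iff)

text \<open>
  The traces give the arcs from the outside into the background; the arcs in the opposite
  direction follow because \<open>G\<close> is symmetric.
\<close>

lemma shadow_iso_glue:
  assumes G: "graph G" and V: "V \<subseteq> verts G" and W: "W \<subseteq> verts G"
    and iso: "shadow_iso (shadow G (G \<restriction> V)) (shadow G (G \<restriction> W))"
  obtains h where "h \<in> isomorphisms_between G G" "iso_verts h ` V = W"
proof -
  interpret graph G by (rule G)
  obtain f g where f: "f \<in> isomorphisms_between (G \<restriction> V) (G \<restriction> W)"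
    and g: "g \<in> isomorphisms_between (G \<restriction> (verts G - V)) (G \<restriction> (verts G - W))"
    and trace: "\<And>s. s \<in> verts G - V \<Longrightarrow>
      neighbourhood G (iso_verts g s) \<inter> W = iso_verts f ` (neighbourhood G s \<inter> V)"
    using iso by (auto simp: shadow_iso_def shadow_def)
  have f_bij: "bij_betw (iso_verts f) V W"
    using isomorphisms_between_bij_betw[OF f] by simp
  have g_bij: "bij_betw (iso_verts g) (verts G - V) (verts G - W)"
    using isomorphisms_between_bij_betw[OF g] by simp
  define \<phi> where "\<phi> v = (if v \<in> V then iso_verts f v else iso_verts g v)" for v
  have "bij_betw \<phi> V W"
    using f_bij by (rule bij_betw_cong[THEN iffD1, rotated]) (simp add: \<phi>_def)
  moreover have "bij_betw \<phi> (verts G - V) (verts G - W)"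
    using g_bij by (rule bij_betw_cong[THEN iffD1, rotated]) (simp add: \<phi>_def)
  ultimately have "bij_betw \<phi> (V \<union> (verts G - V)) (W \<union> (verts G - W))"
    by (rule bij_betw_combine) blast
  then have \<phi>_bij: "bij_betw \<phi> (verts G) (verts G)"
    using V W by (simp add: Un_absorb1)
  have \<phi>_in: "\<phi> v \<in> W" if "v \<in> V" for v
    using that f_bij by (auto simp: \<phi>_def dest: bij_betwE)
  have \<phi>_out: "\<phi> v \<in> verts G - W" if "v \<in> verts G - V" for v
    using that g_bij by (auto simp: \<phi>_def dest: bij_betwE)
  have inside: "\<phi> u \<rightarrow>\<^bsub>G\<^esub> \<phi> v \<longleftrightarrow> u \<rightarrow>\<^bsub>G\<^esub> v" if "u \<in> V" "v \<in> V" for u v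
    using that isomorphisms_between_dominates_iff[OF f, of u v] \<phi>_in[of u] \<phi>_in[of v]
    by (simp add: induce_subgraph_dominates_iff \<phi>_def)
  have outside: "\<phi> u \<rightarrow>\<^bsub>G\<^esub> \<phi> v \<longleftrightarrow> u \<rightarrow>\<^bsub>G\<^esub> v" if "u \<in> verts G - V" "v \<in> verts G - V" for u v
    using that isomorphisms_between_dominates_iff[OF g, of u v] \<phi>_out[of u] \<phi>_out[of v]
    by (simp add: induce_subgraph_dominates_iff \<phi>_def)
  have across: "\<phi> u \<rightarrow>\<^bsub>G\<^esub> \<phi> v \<longleftrightarrow> u \<rightarrow>\<^bsub>G\<^esub> v" if "u \<in> verts G - V" "v \<in> V" for u v
  proof -
    have "\<phi> u \<rightarrow>\<^bsub>G\<^esub> \<phi> v \<longleftrightarrow> \<phi> v \<in> neighbourhood G (iso_verts g u) \<inter> W"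
      using that \<phi>_in[of v] W by (auto simp: neighbourhood_def \<phi>_def)
    also have "\<dots> \<longleftrightarrow> iso_verts f v \<in> iso_verts f ` (neighbourhood G u \<inter> V)"
      using that by (simp add: trace \<phi>_def)
    also have "\<dots> \<longleftrightarrow> v \<in> neighbourhood G u \<inter> V"
      using that f_bij by (intro inj_on_image_mem_iff) (auto simp: bij_betw_def)
    finally show ?thesis
      using that V by (auto simp: neighbourhood_def)
  qed
  have "sym (arcs_ends G)"
    using sym_arcs by (simp add: symmetric_def)
  then have flip: "u \<rightarrow>\<^bsub>G\<^esub> v \<longleftrightarrow> v \<rightarrow>\<^bsub>G\<^esub> u" for u v
    by (auto dest: symD)
  have "\<phi> u \<rightarrow>\<^bsub>G\<^esub> \<phi> v \<longleftrightarrow> u \<rightarrow>\<^bsub>G\<^esub> v" if "u \<in> verts G" "v \<in> verts G" for u v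
    using that inside outside across across[of v u] flip[of u v] flip[of "\<phi> u" "\<phi> v"] by blast
  then obtain h where "h \<in> isomorphisms_between G G" "iso_verts h = \<phi>"
    using isomorphisms_betweenI[OF nomulti_digraph nomulti_digraph \<phi>_bij] by blast
  moreover have "\<phi> ` V = W"
    using \<open>bij_betw \<phi> V W\<close> by (simp add: bij_betw_def)
  ultimately show thesis
    using that by simp
qed

text \<open>
  If \<open>W\<close> has the same shadow graph as \<open>V\<close>, then \<open>W\<close> is the image of \<open>V\<close> under an automorphism,
  so \<open>W \<subseteq> V\<close>, and finiteness of \<open>V\<close> leaves only \<open>W = V\<close>.
\<close>

lemma connective_anchor_if_invariant:
  assumes G: "graph G" and V: "V \<subseteq> verts G" "V \<noteq> {}" "V \<noteq> verts G"
    and inv: "\<And>f. f \<in> isomorphisms_between G G \<Longrightarrow> iso_verts f ` V \<subseteq> V"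
  shows "connective_anchor G (G \<restriction> V)"
proof -
  interpret graph G by (rule G)
  have "W = V" if W: "W \<subseteq> verts G"
    and iso: "shadow_iso (shadow G (G \<restriction> V)) (shadow G (G \<restriction> W))" for W
  proof -
    obtain h where h: "h \<in> isomorphisms_between G G" "iso_verts h ` V = W"
      using shadow_iso_glue[OF G V(1) W iso] .
    have "inj_on (iso_verts h) V"
      using isomorphisms_between_bij_betw[OF h(1)] V(1)
      by (auto simp: bij_betw_def intro: inj_on_subset)
    moreover have "finite V"
      using V(1) finite_verts by (rule finite_subset)
    ultimately show "W = V"
      using endo_inj_surj[of V "iso_verts h"] inv[OF h(1)] h(2) by simp
  qed
  then show ?thesis
    using V induced_induce[OF V(1)] by (auto simp: connective_anchor_def)
qed

theorem corollary1:
  fixes G :: "('a, 'b) pre_digraph"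
  assumes "graph G"
    and "\<not> vertex_transitive G"
  shows "(\<exists>H. anchor G H) \<or> (\<exists>H. connective_anchor G H)"
proof -
  interpret graph G by (rule assms(1))
  obtain u v where u: "u \<in> verts G" and v: "v \<in> verts G"
    and uv: "\<And>f. f \<in> isomorphisms_between G G \<Longrightarrow> iso_verts f u \<noteq> v"
    using assms(2) by (auto simp: vertex_transitive_def)
  define V where "V = {iso_verts f u |f. f \<in> isomorphisms_between G G}"
  have "connective_anchor G (G \<restriction> V)"
  proof (rule connective_anchor_if_invariant[OF assms(1)])
    show "V \<subseteq> verts G"
      using u isomorphisms_between_bij_betw by (fastforce simp: V_def dest: bij_betwE)
    show "V \<noteq> {}"
      using automorphism_id[OF nomulti_digraph] by (auto simp: V_def)
    have "v \<notin> V"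
      using uv by (auto simp: V_def)
    then show "V \<noteq> verts G"
      using v by blast
    show "iso_verts g ` V \<subseteq> V" if g: "g \<in> isomorphisms_between G G" for g
    proof
      fix w assume "w \<in> iso_verts g ` V"
      then obtain f where f: "f \<in> isomorphisms_between G G" and w: "w = iso_verts g (iso_verts f u)"
        by (auto simp: V_def)
      obtain h where "h \<in> isomorphisms_between G G" "iso_verts h = iso_verts g \<circ> iso_verts f"
        using automorphism_comp[OF nomulti_digraph f g] .
      then show "w \<in> V"
        unfolding V_def w by (auto intro!: exI[of _ h])
    qed
  qed
  then show ?thesis
    by blast
qed

end
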